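(* For $i\in\mathbb{N}$ let $A^{\downarrow\downarrow}_i=-x\otimes(t-1)^i$, $B^{\downarrow\downarrow}_i=(-y\otimes t-z\otimes(t-1))(t-1)^i$, $\psi^{\downarrow\downarrow}_{i+1}=(-x\otimes1-y\otimes t)(t-1)^i$; these elements form a basis, denoted $[3021]$, of the Onsager Lie algebra $O$. The basis $[3021]$ is recursively obtained in the order $$A^{\downarrow\downarrow}_0,\ B^{\downarrow\downarrow}_0,\ \psi^{\downarrow\downarrow}_1,\ A^{\downarrow\downarrow}_1,\ B^{\downarrow\downarrow}_1,\ \psi^{\downarrow\downarrow}_2,\ A^{\downarrow\downarrow}_2,\ B^{\downarrow\downarrow}_2,\ \psi^{\downarrow\downarrow}_3,\ \ldots$$ using $A^{\downarrow\downarrow}_0=-A$, $B^{\downarrow\downarrow}_0=-B$ and the following equations for $i\geq1$: $$\begin{aligned} \psi^{\downarrow\downarrow}_i&=\frac{A^{\downarrow\downarrow}_{i-1}}{2}+\frac{B^{\downarrow\downarrow}_{i-1}}{2}+\frac{[A^{\downarrow\downarrow}_{i-1},B]}{4},\\ A^{\downarrow\downarrow}_i&=-\frac{[\psi^{\downarrow\downarrow}_i,A]}{2}-\psi^{\downarrow\downarrow}_i,\\ B^{\downarrow\downarrow}_i&=-\frac{[B,\psi^{\downarrow\downarrow}_i]}{2}-\psi^{\downarrow\downarrow}_i. \end{aligned}$$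
   Context: $\mathbb{F}$ is a field of characteristic zero; $\mathbb{N}=\{0,1,2,\ldots\}$; tensor products are over $\mathbb{F}$. $\mathfrak{sl}_2$ is the Lie algebra over $\mathbb{F}$ with basis $e,f,h$ and $[h,e]=2e$, $[h,f]=-2f$, $[e,f]=h$. Its equitable basis is $x=2e-h$, $y=-2f-h$, $z=h$, which satisfies $[x,y]=2x+2y$, $[y,z]=2y+2z$, $[z,x]=2z+2x$. Let $t$ be an indeterminate and $\mathcal{A}=\mathbb{F}[t,t^{-1},(t-1)^{-1}]$. The three-point $\mathfrak{sl}_2$ loop algebra $L(\mathfrak{sl}_2)^+$ is the vector space $\mathfrak{sl}_2\otimes\mathcal{A}$ with Lie bracket $[u\otimes a,v\otimes b]=[u,v]\otimes ab$. It is a right $\mathcal{A}$-module via $(u\otimes a)b=u\otimes ab$. The Onsager Lie algebra $O$ (generators $A,B$; relations $[A,[A,[A,B]]]=4[A,B]$, $[B,[B,[B,A]]]=4[B,A]$) is identified with the Lie subalgebra of $L(\mathfrak{sl}_2)^+$ generated by $A=x\otimes1$ and $B=y\otimes t+z\otimes(t-1)$. *)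

theory Defs
  imports "HOL-Computational_Algebra.Computational_Algebra"
begin

section \<open>The Lie algebra \<open>sl\<^sub>2\<close> over a commutative ring\<close>

text \<open>\<open>Sl2 a b c\<close> is the element \<open>a e + b f + c h\<close>.  The coefficients may lie in any
  commutative ring, so that the same type also serves for \<open>sl\<^sub>2 \<otimes> R\<close>.\<close>

datatype 'r sl2 = Sl2 (coeff_e: 'r) (coeff_f: 'r) (coeff_h: 'r)

instantiation sl2 :: (ab_group_add) ab_group_add
begin

definition zero_sl2 :: "'a sl2" where "0 = Sl2 0 0 0"

definition plus_sl2 :: "'a sl2 \<Rightarrow> 'a sl2 \<Rightarrow> 'a sl2" where
  "u + v = Sl2 (coeff_e u + coeff_e v) (coeff_f u + coeff_f v) (coeff_h u + coeff_h v)"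

definition minus_sl2 :: "'a sl2 \<Rightarrow> 'a sl2 \<Rightarrow> 'a sl2" where
  "u - v = Sl2 (coeff_e u - coeff_e v) (coeff_f u - coeff_f v) (coeff_h u - coeff_h v)"

definition uminus_sl2 :: "'a sl2 \<Rightarrow> 'a sl2" where
  "- u = Sl2 (- coeff_e u) (- coeff_f u) (- coeff_h u)"

instance
  by standard
    (auto simp: zero_sl2_def plus_sl2_def minus_sl2_def uminus_sl2_def algebra_simps)

end

lemmas sl2_ops = zero_sl2_def plus_sl2_def minus_sl2_def uminus_sl2_def

definition sl2_scale :: "'r::comm_ring_1 \<Rightarrow> 'r sl2 \<Rightarrow> 'r sl2" where
  "sl2_scale c u = Sl2 (c * coeff_e u) (c * coeff_f u) (c * coeff_h u)"

text \<open>The bilinear alternating extension of \<open>[h,e] = 2e\<close>, \<open>[h,f] = -2f\<close>, \<open>[e,f] = h\<close>.\<close>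

definition lie_bracket :: "'r::comm_ring_1 sl2 \<Rightarrow> 'r sl2 \<Rightarrow> 'r sl2"  (\<open>[_, _]\<^sub>L\<close>) where
  "[u, v]\<^sub>L = Sl2 (2 * (coeff_h u * coeff_e v - coeff_e u * coeff_h v))
                 (- 2 * (coeff_h u * coeff_f v - coeff_f u * coeff_h v))
                 (coeff_e u * coeff_f v - coeff_f u * coeff_e v)"

definition sl2_e :: "'r::comm_ring_1 sl2" where "sl2_e = Sl2 1 0 0"
definition sl2_f :: "'r::comm_ring_1 sl2" where "sl2_f = Sl2 0 1 0"
definition sl2_h :: "'r::comm_ring_1 sl2" where "sl2_h = Sl2 0 0 1"

definition sl2_x :: "'r::comm_ring_1 sl2" where "sl2_x = sl2_scale 2 sl2_e - sl2_h"
definition sl2_y :: "'r::comm_ring_1 sl2" where "sl2_y = sl2_scale (- 2) sl2_f - sl2_h"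
definition sl2_z :: "'r::comm_ring_1 sl2" where "sl2_z = sl2_h"

lemmas sl2_basis_defs = sl2_e_def sl2_f_def sl2_h_def sl2_x_def sl2_y_def sl2_z_def

lemma bracket_basis:
  "[sl2_h, sl2_e]\<^sub>L = sl2_scale 2 (sl2_e :: 'r::comm_ring_1 sl2)"
  "[sl2_h, sl2_f]\<^sub>L = sl2_scale (- 2) (sl2_f :: 'r::comm_ring_1 sl2)"
  "[sl2_e, sl2_f]\<^sub>L = (sl2_h :: 'r::comm_ring_1 sl2)"
  by (simp_all add: sl2_basis_defs lie_bracket_def sl2_scale_def)

lemma bracket_equitable:
  "[sl2_x, sl2_y]\<^sub>L = sl2_scale 2 (sl2_x :: 'r::comm_ring_1 sl2) + sl2_scale 2 sl2_y"
  "[sl2_y, sl2_z]\<^sub>L = sl2_scale 2 (sl2_y :: 'r::comm_ring_1 sl2) + sl2_scale 2 sl2_z"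
  "[sl2_z, sl2_x]\<^sub>L = sl2_scale 2 (sl2_z :: 'r::comm_ring_1 sl2) + sl2_scale 2 sl2_x"
  by (simp_all add: sl2_basis_defs lie_bracket_def sl2_scale_def sl2_ops)

lemma bracket_self: "[u, u]\<^sub>L = 0"
  by (simp add: lie_bracket_def sl2_ops)

lemma bracket_jacobi: "[u, [v, w]\<^sub>L]\<^sub>L + [v, [w, u]\<^sub>L]\<^sub>L + [w, [u, v]\<^sub>L]\<^sub>L = 0"
  by (simp add: lie_bracket_def sl2_ops algebra_simps)

lemma bracket_bilinear:
  "[u + v, w]\<^sub>L = [u, w]\<^sub>L + [v, w]\<^sub>L"
  "[w, u + v]\<^sub>L = [w, u]\<^sub>L + [w, v]\<^sub>L"
  "[sl2_scale c u, w]\<^sub>L = sl2_scale c [u, w]\<^sub>L"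
  "[w, sl2_scale c u]\<^sub>L = sl2_scale c [w, u]\<^sub>L"
  by (simp_all add: lie_bracket_def sl2_ops sl2_scale_def algebra_simps)


section \<open>The ring \<open>F[t, t\<^sup>-\<^sup>1, (t-1)\<^sup>-\<^sup>1]\<close>\<close>

text \<open>Realised inside the field of rational functions, as the fractions whose denominator is
  \<open>t\<^sup>m (t-1)\<^sup>n\<close>.\<close>

typedef (overloaded) ('a::field) three_point =
  "{Fract p ([:0, 1:] ^ m * [:- 1, 1:] ^ n) | (p :: 'a poly) m n. True}"
  morphisms rat_fun Abs_three_point
  by blast

setup_lifting type_definition_three_point

lemma three_point_denom_nonzero [simp]:
  "[:0, 1:] ^ m * [:- 1, 1:] ^ n \<noteq> (0 :: 'a::field poly)"
  by simp

instantiation three_point :: (field) comm_ring_1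
begin

lift_definition zero_three_point :: "'a three_point" is 0
proof -
  have "0 = Fract (0 :: 'a poly) ([:0, 1:] ^ 0 * [:- 1, 1:] ^ 0)"
    by (simp add: Zero_fract_def)
  then show "\<exists>p m n. 0 = Fract (p :: 'a poly) ([:0, 1:] ^ m * [:- 1, 1:] ^ n) \<and> True"
    by blast
qed

lift_definition one_three_point :: "'a three_point" is 1
proof -
  have "1 = Fract (1 :: 'a poly) ([:0, 1:] ^ 0 * [:- 1, 1:] ^ 0)"
    by (simp add: One_fract_def)
  then show "\<exists>p m n. 1 = Fract (p :: 'a poly) ([:0, 1:] ^ m * [:- 1, 1:] ^ n) \<and> True"
    by blast
qed

lift_definition plus_three_point :: "'a three_point \<Rightarrow> 'a three_point \<Rightarrow> 'a three_point" is "(+)"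
proof clarify
  fix p q :: "'a poly" and m n k l :: nat
  let ?d = "[:0, 1:] ^ m * [:- 1, 1:] ^ n :: 'a poly"
  let ?d' = "[:0, 1:] ^ k * [:- 1, 1:] ^ l :: 'a poly"
  have "Fract p ?d + Fract q ?d' = Fract (p * ?d' + q * ?d) (?d * ?d')"
    by (rule add_fract) (rule three_point_denom_nonzero)+
  also have "?d * ?d' = [:0, 1:] ^ (m + k) * [:- 1, 1:] ^ (n + l)"
    by (simp only: power_add mult_ac)
  finally show "\<exists>r i j. Fract p ?d + Fract q ?d' = Fract r ([:0, 1:] ^ i * [:- 1, 1:] ^ j) \<and> True"
    by blast
qed

lift_definition uminus_three_point :: "'a three_point \<Rightarrow> 'a three_point" is uminus
  by (metis minus_fract)

definition minus_three_point :: "'a three_point \<Rightarrow> 'a three_point \<Rightarrow> 'a three_point" where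
  "a - b = a + - (b :: 'a three_point)"

lift_definition times_three_point :: "'a three_point \<Rightarrow> 'a three_point \<Rightarrow> 'a three_point" is "(*)"
proof clarify
  fix p q :: "'a poly" and m n k l :: nat
  let ?d = "[:0, 1:] ^ m * [:- 1, 1:] ^ n :: 'a poly"
  let ?d' = "[:0, 1:] ^ k * [:- 1, 1:] ^ l :: 'a poly"
  have "Fract p ?d * Fract q ?d' = Fract (p * q) (?d * ?d')"
    by (rule mult_fract)
  also have "?d * ?d' = [:0, 1:] ^ (m + k) * [:- 1, 1:] ^ (n + l)"
    by (simp only: power_add mult_ac)
  finally show "\<exists>r i j. Fract p ?d * Fract q ?d' = Fract r ([:0, 1:] ^ i * [:- 1, 1:] ^ j) \<and> True"
    by blast
qed

instance
  by standard (simp_all add: minus_three_point_def, (transfer, simp add: algebra_simps)+)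

end

definition tp_of_poly :: "'a::field poly \<Rightarrow> 'a three_point" where
  "tp_of_poly p = Abs_three_point (to_fract p)"

lemma rat_fun_tp_of_poly: "rat_fun (tp_of_poly p) = to_fract p"
proof -
  have "to_fract p = Fract p ([:0, 1:] ^ 0 * [:- 1, 1:] ^ 0)"
    by (simp add: to_fract_def)
  then show ?thesis
    unfolding tp_of_poly_def by (intro Abs_three_point_inverse) blast
qed

definition tp_const :: "'a::field \<Rightarrow> 'a three_point" where
  "tp_const c = tp_of_poly [:c:]"

definition tp_t :: "'a::field three_point" where
  "tp_t = tp_of_poly [:0, 1:]"

lemma tp_of_poly_ring_hom:
  "tp_of_poly (p + q) = tp_of_poly p + tp_of_poly q"
  "tp_of_poly (p * q) = tp_of_poly p * tp_of_poly q"
  "tp_of_poly 1 = 1" "tp_of_poly 0 = 0"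
  by (simp_all add: rat_fun_inject [symmetric] rat_fun_tp_of_poly plus_three_point.rep_eq
      times_three_point.rep_eq one_three_point.rep_eq zero_three_point.rep_eq)

lemma tp_const_ring_hom:
  "tp_const (a + b) = tp_const a + tp_const b"
  "tp_const (a * b) = tp_const a * tp_const b"
  "tp_const 1 = 1" "tp_const 0 = 0"
  by (simp_all add: tp_const_def tp_of_poly_ring_hom [symmetric] one_pCons mult.commute)

lemma tp_t_unit: "tp_t dvd (1 :: 'a::field three_point)"
proof -
  define s where "s = Abs_three_point (Fract (1 :: 'a poly) [:0, 1:])"
  have "Fract (1 :: 'a poly) [:0, 1:] = Fract 1 ([:0, 1:] ^ 1 * [:- 1, 1:] ^ 0)"
    by simp
  then have "rat_fun s = Fract (1 :: 'a poly) [:0, 1:]"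
    unfolding s_def by (intro Abs_three_point_inverse) blast
  then have "rat_fun (tp_t * s) = rat_fun 1"
    by (simp add: tp_t_def times_three_point.rep_eq one_three_point.rep_eq rat_fun_tp_of_poly
        to_fract_def One_fract_def eq_fract)
  then show ?thesis
    by (metis rat_fun_inject dvd_triv_left)
qed

lemma tp_t_minus_one_unit: "tp_t - 1 dvd (1 :: 'a::field three_point)"
proof -
  define s where "s = Abs_three_point (Fract (1 :: 'a poly) [:- 1, 1:])"
  have "Fract (1 :: 'a poly) [:- 1, 1:] = Fract 1 ([:0, 1:] ^ 0 * [:- 1, 1:] ^ 1)"
    by simp
  then have s: "rat_fun s = Fract (1 :: 'a poly) [:- 1, 1:]"
    unfolding s_def by (intro Abs_three_point_inverse) blast
  have "tp_t = tp_of_poly [:- 1, 1:] + (1 :: 'a three_point)"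
    by (simp add: tp_t_def tp_of_poly_ring_hom(3) [symmetric]
        tp_of_poly_ring_hom(1) [symmetric] one_pCons)
  then have "tp_t - 1 = (tp_of_poly [:- 1, 1:] :: 'a three_point)"
    by (simp only: diff_eq_eq)
  with s have "rat_fun ((tp_t - 1) * s) = rat_fun 1"
    by (simp add: times_three_point.rep_eq one_three_point.rep_eq rat_fun_tp_of_poly
        to_fract_def One_fract_def eq_fract)
  then show ?thesis
    by (metis rat_fun_inject dvd_triv_left)
qed


section \<open>The three-point loop algebra \<open>L(sl\<^sub>2)\<^sup>+ = sl\<^sub>2 \<otimes> F[t, t\<^sup>-\<^sup>1, (t-1)\<^sup>-\<^sup>1]\<close>\<close>

text \<open>The tensor product is modelled by its coordinates with respect to the basis \<open>e, f, h\<close> of the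
  left factor.  The lemmas \<open>tensor_bilinear\<close> and \<open>tensor_universal\<close> below say that \<open>(\<otimes>)\<close> is the
  universal bilinear map, and \<open>bracket_tensor\<close> and \<open>loop_act_tensor\<close> are the formulas that
  determine the Lie bracket and the module structure on pure tensors.\<close>

type_synonym 'a loop = "'a three_point sl2"

definition tensor :: "'a::field sl2 \<Rightarrow> 'a three_point \<Rightarrow> 'a loop"  (infixl \<open>\<otimes>\<close> 75) where
  "u \<otimes> a = Sl2 (tp_const (coeff_e u) * a) (tp_const (coeff_f u) * a) (tp_const (coeff_h u) * a)"

definition loop_scale :: "'a::field \<Rightarrow> 'a loop \<Rightarrow> 'a loop"  (infixr \<open>*\<^sub>F\<close> 76) where
  "c *\<^sub>F v = sl2_scale (tp_const c) v"

definition loop_act :: "'a::field loop \<Rightarrow> 'a three_point \<Rightarrow> 'a loop"  (infixl \<open>\<cdot>\<close> 74) where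
  "v \<cdot> b = sl2_scale b v"

interpretation loop: vector_space "loop_scale :: 'a::field \<Rightarrow> _"
  by standard
    (simp_all add: loop_scale_def sl2_scale_def sl2_ops tp_const_ring_hom algebra_simps)

lemma bracket_tensor: "[u \<otimes> a, v \<otimes> b]\<^sub>L = [u, v]\<^sub>L \<otimes> (a * b)"
proof -
  have neg: "tp_const (- c) = - tp_const c" for c :: 'a
    by (metis add.right_inverse add_eq_0_iff tp_const_ring_hom(1,4))
  have diff: "tp_const (c - d) = tp_const c - tp_const d" for c d :: 'a
    by (metis neg diff_conv_add_uminus tp_const_ring_hom(1))
  have two: "tp_const 2 = (2 :: 'a three_point)"
    by (metis one_add_one tp_const_ring_hom(1,3))
  show ?thesis
    by (simp add: tensor_def lie_bracket_def tp_const_ring_hom neg diff two algebra_simps)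
qed

lemma loop_act_tensor: "(u \<otimes> a) \<cdot> b = u \<otimes> (a * b)"
  by (simp add: tensor_def loop_act_def sl2_scale_def algebra_simps)

lemma tensor_bilinear:
  "(u + v) \<otimes> a = u \<otimes> a + v \<otimes> a"
  "u \<otimes> (a + b) = u \<otimes> a + u \<otimes> b"
  "sl2_scale c u \<otimes> a = c *\<^sub>F (u \<otimes> a)"
  "u \<otimes> (tp_const c * a) = c *\<^sub>F (u \<otimes> a)"
  by (simp_all add: tensor_def sl2_ops sl2_scale_def loop_scale_def tp_const_ring_hom algebra_simps)

lemma loop_decompose:
  "v = sl2_e \<otimes> coeff_e v + sl2_f \<otimes> coeff_f v + sl2_h \<otimes> coeff_h v"
  by (cases v) (simp add: tensor_def sl2_ops sl2_basis_defs tp_const_ring_hom)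

lemma tensor_universal:
  fixes scaleW :: "'a::field \<Rightarrow> 'w::ab_group_add \<Rightarrow> 'w"
    and \<phi> :: "'a sl2 \<Rightarrow> 'a three_point \<Rightarrow> 'w"
  assumes W: "vector_space scaleW"
    and add_left: "\<And>u v a. \<phi> (u + v) a = \<phi> u a + \<phi> v a"
    and add_right: "\<And>u a b. \<phi> u (a + b) = \<phi> u a + \<phi> u b"
    and scale_left: "\<And>c u a. \<phi> (sl2_scale c u) a = scaleW c (\<phi> u a)"
    and scale_right: "\<And>c u a. \<phi> u (tp_const c * a) = scaleW c (\<phi> u a)"
  shows "\<exists>!g. Vector_Spaces.linear loop_scale scaleW g \<and> (\<forall>u a. g (u \<otimes> a) = \<phi> u a)"
proof (rule ex1I)
  interpret W: vector_space scaleW by (fact W)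
  let ?g = "\<lambda>v. \<phi> sl2_e (coeff_e v) + \<phi> sl2_f (coeff_f v) + \<phi> sl2_h (coeff_h v)"
  have "Vector_Spaces.linear loop_scale scaleW ?g"
    by unfold_locales
      (simp_all add: sl2_ops loop_scale_def sl2_scale_def add_right scale_right
        W.scale_right_distrib add_ac)
  moreover have "?g (u \<otimes> a) = \<phi> u a" for u a
  proof -
    have "u = sl2_scale (coeff_e u) sl2_e + sl2_scale (coeff_f u) sl2_f
            + sl2_scale (coeff_h u) sl2_h"
      by (cases u) (simp add: sl2_scale_def sl2_ops sl2_basis_defs)
    then have "\<phi> u a = scaleW (coeff_e u) (\<phi> sl2_e a) + scaleW (coeff_f u) (\<phi> sl2_f a)
            + scaleW (coeff_h u) (\<phi> sl2_h a)"
      by (metis add_left scale_left)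
    then show ?thesis
      by (simp add: tensor_def scale_right)
  qed
  ultimately show "Vector_Spaces.linear loop_scale scaleW ?g \<and> (\<forall>u a. ?g (u \<otimes> a) = \<phi> u a)"
    by blast
  show "g = ?g"
    if g: "Vector_Spaces.linear loop_scale scaleW g \<and> (\<forall>u a. g (u \<otimes> a) = \<phi> u a)" for g
  proof
    fix v
    interpret g: Vector_Spaces.linear loop_scale scaleW g
      using g by blast
    show "g v = ?g v"
      by (subst loop_decompose) (simp only: g.add g [THEN conjunct2, rule_format])
  qed
qed


section \<open>The Onsager Lie algebra\<close>

definition lie_subalgebra :: "'a::field loop set \<Rightarrow> bool" where
  "lie_subalgebra S \<longleftrightarrow> loop.subspace S \<and> (\<forall>u\<in>S. \<forall>v\<in>S. [u, v]\<^sub>L \<in> S)"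

definition onsager_A :: "'a::field loop" where
  "onsager_A = sl2_x \<otimes> 1"

definition onsager_B :: "'a::field loop" where
  "onsager_B = sl2_y \<otimes> tp_t + sl2_z \<otimes> (tp_t - 1)"

definition onsager :: "'a::field loop set" where
  "onsager = lie_subalgebra hull {onsager_A, onsager_B}"

text \<open>The generators satisfy the defining relations of the abstract Onsager Lie algebra, which is
  identified with this subalgebra.\<close>

lemma onsager_relations:
  fixes A B :: "'a::field loop"
  defines "A \<equiv> onsager_A" and "B \<equiv> onsager_B"
  shows "[A, [A, [A, B]\<^sub>L]\<^sub>L]\<^sub>L = 4 *\<^sub>F [A, B]\<^sub>L"
    and "[B, [B, [B, A]\<^sub>L]\<^sub>L]\<^sub>L = 4 *\<^sub>F [B, A]\<^sub>L"
proof -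
  have two: "tp_const 2 = (2 :: 'a three_point)"
    by (metis one_add_one tp_const_ring_hom(1,3))
  have four: "tp_const 4 = (4 :: 'a three_point)"
    by (metis numeral_Bit0 two tp_const_ring_hom(1))
  have neg: "tp_const (- c) = - tp_const c" for c :: 'a
    by (metis add.right_inverse add_eq_0_iff tp_const_ring_hom(1,4))
  note defs = A_def B_def onsager_A_def onsager_B_def tensor_def sl2_ops sl2_basis_defs
    lie_bracket_def loop_scale_def sl2_scale_def neg two four tp_const_ring_hom
  show "[A, [A, [A, B]\<^sub>L]\<^sub>L]\<^sub>L = 4 *\<^sub>F [A, B]\<^sub>L"
    and "[B, [B, [B, A]\<^sub>L]\<^sub>L]\<^sub>L = 4 *\<^sub>F [B, A]\<^sub>L"
    by (simp_all add: defs algebra_simps)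
qed

text \<open>The order \<open>A\<^sub>0, B\<^sub>0, \<psi>\<^sub>1, A\<^sub>1, B\<^sub>1, \<psi>\<^sub>2, \<dots>\<close>; the value \<open>\<psi> 0\<close> is never used.\<close>

definition interleave :: "(nat \<Rightarrow> 'b) \<Rightarrow> (nat \<Rightarrow> 'b) \<Rightarrow> (nat \<Rightarrow> 'b) \<Rightarrow> nat \<Rightarrow> 'b" where
  "interleave A B \<psi> n =
    (if n mod 3 = 0 then A (n div 3) else if n mod 3 = 1 then B (n div 3) else \<psi> (n div 3 + 1))"

definition family_basis_of :: "(nat \<Rightarrow> 'a::field loop) \<Rightarrow> 'a loop set \<Rightarrow> bool" where
  "family_basis_of v S \<longleftrightarrow> inj v \<and> loop.independent (range v) \<and> loop.span (range v) = S"

text \<open>The initial values and equations of the recursion in that order; each equation expresses an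
  element through elements that precede it and the generators \<open>A = onsager_A\<close>, \<open>B = onsager_B\<close>.\<close>

definition recursion_3021 ::
  "(nat \<Rightarrow> 'a::field loop) \<Rightarrow> (nat \<Rightarrow> 'a loop) \<Rightarrow> (nat \<Rightarrow> 'a loop) \<Rightarrow> bool" where
  "recursion_3021 Add Bdd \<psi> \<longleftrightarrow>
     Add 0 = - onsager_A \<and> Bdd 0 = - onsager_B \<and>
     (\<forall>i\<ge>1.
        \<psi> i = (1/2) *\<^sub>F Add (i - 1) + (1/2) *\<^sub>F Bdd (i - 1) + (1/4) *\<^sub>F [Add (i - 1), onsager_B]\<^sub>L \<and>
        Add i = - ((1/2) *\<^sub>F [\<psi> i, onsager_A]\<^sub>L) - \<psi> i \<and>
        Bdd i = - ((1/2) *\<^sub>F [onsager_B, \<psi> i]\<^sub>L) - \<psi> i)"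

end

theory Submission
  imports Defs
begin

text \<open>Put \<open>s = t - 1\<close>, \<open>X = x \<otimes> 1\<close>, \<open>Y = y \<otimes> t + z \<otimes> s\<close> and \<open>P = - x \<otimes> 1 - y \<otimes> t\<close>.  Then
  \<open>[X, Y] = - 4 P - 2 X - 2 Y\<close>, \<open>[P, X] = 2 s X - 2 P\<close> and \<open>[Y, P] = 2 s Y - 2 P\<close>, so the
  \<open>F[s]\<close>-span of \<open>X, Y, P\<close> is a Lie subalgebra; it contains the generators \<open>X, Y\<close> of the Onsager
  algebra.  Specialised to the generators, the same three brackets are the recursion, which
  therefore puts every member of the family into the Onsager algebra.  Independence holds because
  \<open>X, Y, P\<close> are independent over the domain \<open>F[t, t\<^sup>-\<^sup>1, (t-1)\<^sup>-\<^sup>1]\<close> and the powers of \<open>s\<close> are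
  independent over \<open>F\<close>.\<close>

section \<open>Domain property and independence of sequences\<close>

instance three_point :: (field) idom
  by standard (transfer, simp)

context vector_space
begin

text \<open>Lets injectivity and independence be checked at once, on relations over initial segments
  of the index set.\<close>

lemma inj_independent_rangeI:
  fixes v :: "nat \<Rightarrow> 'b"
  assumes *: "\<And>c N n. (\<Sum>i<N. c i *s v i) = 0 \<Longrightarrow> n < N \<Longrightarrow> c n = 0"
  shows "inj v \<and> independent (range v)"
proof
  show inj: "inj v"
  proof (rule injI, rule ccontr)
    fix i j assume "v i = v j" "i \<noteq> j"
    \<comment> \<open>The relation \<open>v i - v j = 0\<close>; the bound
      \<open>Suc (i + j)\<close> covers both indices.\<close>
    define c where "c = (\<lambda>n. if n = i then 1 else if n = j then - 1 else 0 :: 'a)"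
    have "(\<Sum>n<Suc (i + j). c n *s v n) = (\<Sum>n\<in>{i, j}. c n *s v n)"
      by (rule sum.mono_neutral_right) (auto simp: c_def)
    also have "\<dots> = 0"
      using \<open>v i = v j\<close> \<open>i \<noteq> j\<close> by (simp add: c_def)
    finally have "c i = 0"
      by (rule *) simp
    then show False
      by (simp add: c_def)
  qed
  show "independent (range v)"
    unfolding independent_explicit_finite_subsets
  proof (intro allI impI ballI)
    fix S u x
    assume "S \<subseteq> range v" "finite S" and sum: "(\<Sum>x\<in>S. u x *s x) = 0" and "x \<in> S"
    obtain T where T: "S = v ` T" "finite T"
      using finite_subset_image [OF \<open>finite S\<close> \<open>S \<subseteq> range v\<close>] by auto
    obtain N where N: "T \<subseteq> {..<N}"
      using finite_nat_bounded [OF \<open>finite T\<close>] by auto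
    \<comment> \<open>Pull the relation back along \<open>v\<close> and pad it with zeros; the
      injectivity just proved turns the sum over \<open>S\<close> into one over
      \<open>T\<close>.\<close>
    define c where "c = (\<lambda>n. if n \<in> T then u (v n) else 0)"
    have "(\<Sum>n<N. c n *s v n) = (\<Sum>n\<in>T. u (v n) *s v n)"
      using N by (intro sum.mono_neutral_cong_right) (auto simp: c_def)
    also have "\<dots> = (\<Sum>x\<in>S. u x *s x)"
      unfolding T by (rule sum.reindex [unfolded comp_def, symmetric])
        (rule inj_on_subset [OF inj subset_UNIV])
    finally have "c n = 0" if "n < N" for n
      using * sum that by metis
    moreover obtain n where "n \<in> T" "x = v n"
      using \<open>x \<in> S\<close> T by auto
    ultimately show "u x = 0"
      using N by (fastforce simp: c_def)
  qed
qed

end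

section \<open>Constants and powers of \<open>t - 1\<close> in the three-point ring\<close>

lemma tp_const_neg: "tp_const (- c) = - tp_const c"
  by (metis add.right_inverse add_eq_0_iff tp_const_ring_hom(1,4))

lemma tp_const_2: "tp_const 2 = 2"
  by (metis one_add_one tp_const_ring_hom(1,3))

lemma tp_const_4: "tp_const 4 = 4"
  by (metis numeral_Bit0 tp_const_2 tp_const_ring_hom(1))

text \<open>Characteristic zero enters here: 2 is a nonzero constant polynomial, and polynomials
  embed into the rational functions.\<close>

lemma two_neq_zero_three_point: "(2 :: 'a::field_char_0 three_point) \<noteq> 0"
proof
  assume "(2 :: 'a three_point) = 0"
  then have "rat_fun (tp_of_poly [:2 :: 'a:]) = rat_fun (tp_of_poly 0)"
    by (simp add: tp_const_2 [unfolded tp_const_def] tp_of_poly_ring_hom)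
  then show False
    by (simp add: rat_fun_tp_of_poly)
qed

lemma tp_of_poly_power: "tp_of_poly (p ^ n) = tp_of_poly p ^ n"
  by (induction n) (simp_all add: tp_of_poly_ring_hom)

lemma tp_of_poly_sum: "tp_of_poly (sum p A) = (\<Sum>i\<in>A. tp_of_poly (p i))"
  by (induction A rule: infinite_finite_induct) (simp_all add: tp_of_poly_ring_hom)

lemma tp_of_poly_eq_0_iff: "tp_of_poly p = 0 \<longleftrightarrow> p = 0"
  by (simp add: rat_fun_inject [symmetric] rat_fun_tp_of_poly zero_three_point.rep_eq)

lemma tp_t_minus_one: "tp_t - 1 = tp_of_poly [:- 1, 1:]"
proof -
  have "tp_t = tp_of_poly [:- 1, 1:] + (1 :: 'a three_point)"
    by (simp add: tp_t_def tp_of_poly_ring_hom(3) [symmetric]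
        tp_of_poly_ring_hom(1) [symmetric] one_pCons)
  then show ?thesis
    by (simp only: diff_eq_eq)
qed

lemma tp_t_neq_0: "tp_t \<noteq> 0" "tp_t - 1 \<noteq> 0"
  unfolding tp_t_minus_one by (simp_all add: tp_t_def tp_of_poly_eq_0_iff)

lemma pcompose_power: "pcompose (p ^ n) q = pcompose p q ^ n" for p q :: "'a::comm_semiring_1 poly"
  by (induction n) (simp_all add: pcompose_1 pcompose_mult)

text \<open>The sum is the polynomial with coefficients \<open>c\<close> after the substitution of
  \<open>t - 1\<close>. Composition with a polynomial of positive degree sends only 0 to 0.\<close>

lemma powers_tp_t_minus_one_independent:
  assumes "(\<Sum>k<N. tp_const (c k) * (tp_t - 1) ^ k) = 0" "k < N"
  shows "c k = 0"
proof -
  define p where "p = (\<Sum>k<N. monom (c k) k)"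
  have "tp_of_poly (pcompose p [:- 1, 1:]) = (\<Sum>k<N. tp_const (c k) * (tp_t - 1) ^ k)"
    by (simp add: p_def pcompose_sum tp_of_poly_sum tp_t_minus_one tp_const_def
        tp_of_poly_power [symmetric] tp_of_poly_ring_hom(2) [symmetric] monom_altdef
        pcompose_smult pcompose_power pcompose_pCons)
  then have "pcompose p [:- 1, 1:] = 0"
    using assms by (simp add: tp_of_poly_eq_0_iff)
  then have "p = 0"
    by (rule pcompose_eq_0) simp
  moreover have "coeff p k = c k"
    using \<open>k < N\<close> by (simp add: p_def coeff_sum)
  ultimately show ?thesis
    by simp
qed

section \<open>Brackets and Lie subalgebras\<close>

lemma tensor_equitable:
  "sl2_x \<otimes> a = Sl2 (2 * a) 0 (- a)"
  "sl2_y \<otimes> a = Sl2 0 (- 2 * a) (- a)"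
  "sl2_z \<otimes> a = Sl2 0 0 a"
  by (simp_all add: tensor_def sl2_basis_defs sl2_ops sl2_scale_def tp_const_neg tp_const_2
      tp_const_ring_hom)

lemma bracket_swap: "[u, v]\<^sub>L = - [v, u]\<^sub>L"
  by (simp add: lie_bracket_def sl2_ops algebra_simps)

lemma bracket_neg: "[- u, v]\<^sub>L = - [u, v]\<^sub>L" "[u, - v]\<^sub>L = - [u, v]\<^sub>L"
  by (simp_all add: lie_bracket_def sl2_ops algebra_simps)

lemma bracket_loop_scale:
  "[c *\<^sub>F u, v]\<^sub>L = c *\<^sub>F [u, v]\<^sub>L" "[u, c *\<^sub>F v]\<^sub>L = c *\<^sub>F [u, v]\<^sub>L"
  by (simp_all add: loop_scale_def bracket_bilinear)

text \<open>Bilinearity: extend from generators to the span in the second argument first, then in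
  the first.\<close>

lemma lie_subalgebra_span:
  assumes gen: "\<And>u v. u \<in> G \<Longrightarrow> v \<in> G \<Longrightarrow> [u, v]\<^sub>L \<in> loop.span G"
  shows "lie_subalgebra (loop.span G)"
proof -
  have zero: "[0, v]\<^sub>L = 0" "[v, 0]\<^sub>L = 0" for v :: "'a loop"
    by (simp_all add: lie_bracket_def sl2_ops)
  have left: "[u, v]\<^sub>L \<in> loop.span G" if "u \<in> G" "v \<in> loop.span G" for u v
    using that(2)
    by (induction rule: loop.span_induct_alt)
      (auto simp: zero bracket_bilinear bracket_loop_scale
        intro: loop.span_zero loop.span_add loop.span_scale gen that(1))
  have "[u, v]\<^sub>L \<in> loop.span G" if "u \<in> loop.span G" "v \<in> loop.span G" for u v
    using that(1)
    by (induction rule: loop.span_induct_alt)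
      (auto simp: zero bracket_bilinear bracket_loop_scale
        intro: loop.span_zero loop.span_add loop.span_scale left that(2))
  then show ?thesis
    by (simp add: lie_subalgebra_def loop.subspace_span)
qed

text \<open>An intersection of Lie subalgebras is a Lie subalgebra, so the hull is one.\<close>

lemma lie_subalgebra_onsager: "lie_subalgebra onsager"
  unfolding onsager_def
  by (rule hull_in) (auto simp: lie_subalgebra_def intro: loop.subspace_Inter)

lemma onsager_generators: "onsager_A \<in> onsager" "onsager_B \<in> onsager"
  unfolding onsager_def by (simp_all add: hull_inc)

section \<open>The interleaved order and uniqueness of the recursion\<close>

lemma interleave_simps [simp]:
  "interleave A B \<psi> (3 * n) = A n"
  "interleave A B \<psi> (Suc (3 * n)) = B n"
  "interleave A B \<psi> (Suc (Suc (3 * n))) = \<psi> (Suc n)"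
proof -
  have "Suc (3 * n) div 3 = n" "Suc (3 * n) mod 3 = 1"
    "Suc (Suc (3 * n)) div 3 = n" "Suc (Suc (3 * n)) mod 3 = 2"
    by presburger+
  then show "interleave A B \<psi> (3 * n) = A n" "interleave A B \<psi> (Suc (3 * n)) = B n"
    "interleave A B \<psi> (Suc (Suc (3 * n))) = \<psi> (Suc n)"
    by (simp_all add: interleave_def)
qed

lemma nat_mod_3_cases:
  fixes n :: nat
  obtains k where "n = 3 * k" | k where "n = Suc (3 * k)" | k where "n = Suc (Suc (3 * k))"
proof -
  have "\<exists>k. n = 3 * k \<or> n = Suc (3 * k) \<or> n = Suc (Suc (3 * k))"
    by presburger
  then show ?thesis
    using that by blast
qed

lemma range_interleave: "range (interleave A B \<psi>) = range A \<union> range B \<union> range (\<lambda>i. \<psi> (i + 1))"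
  (is "?L = ?R")
proof
  show "?L \<subseteq> ?R"
  proof clarify
    fix n assume "interleave A B \<psi> n \<notin> range (\<lambda>i. \<psi> (i + 1))" "interleave A B \<psi> n \<notin> range B"
    then show "interleave A B \<psi> n \<in> range A"
      by (cases n rule: nat_mod_3_cases) auto
  qed
  show "?R \<subseteq> ?L"
    by (auto intro: range_eqI [of _ _ "3 * n" for n] range_eqI [of _ _ "Suc (3 * n)" for n]
        range_eqI [of _ _ "Suc (Suc (3 * n))" for n])
qed

text \<open>Cuts a sum along the interleaved order into blocks \<open>A k\<close>,
  \<open>B k\<close>, \<open>\<psi> (k + 1)\<close>.\<close>

lemma sum_lessThan_triple:
  fixes f :: "nat \<Rightarrow> 'b::comm_monoid_add"
  shows "(\<Sum>n<3 * N. f n) = (\<Sum>k<N. f (3 * k) + f (Suc (3 * k)) + f (Suc (Suc (3 * k))))"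
  by (induction N) (simp_all add: numeral_3_eq_3 add_ac)

lemma coeff_sum_sl2:
  "coeff_e (sum v A) = (\<Sum>i\<in>A. coeff_e (v i))"
  "coeff_f (sum v A) = (\<Sum>i\<in>A. coeff_f (v i))"
  "coeff_h (sum v A) = (\<Sum>i\<in>A. coeff_h (v i))"
  by (induction A rule: infinite_finite_induct) (simp_all add: sl2_ops)

text \<open>\<open>A i\<close> and \<open>B i\<close> determine \<open>\<psi> (i + 1)\<close>, which
  determines \<open>A (i + 1)\<close> and \<open>B (i + 1)\<close>. The interleaved sequences are
  compared because the recursion leaves \<open>\<psi> 0\<close> free.\<close>

lemma recursion_3021_unique:
  assumes "recursion_3021 A B \<psi>" "recursion_3021 A' B' \<psi>'"
  shows "interleave A' B' \<psi>' = interleave A B \<psi>"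
proof -
  have step: "\<psi> (i + 1) = (1/2) *\<^sub>F A i + (1/2) *\<^sub>F B i + (1/4) *\<^sub>F [A i, onsager_B]\<^sub>L"
    "A (i + 1) = - ((1/2) *\<^sub>F [\<psi> (i + 1), onsager_A]\<^sub>L) - \<psi> (i + 1)"
    "B (i + 1) = - ((1/2) *\<^sub>F [onsager_B, \<psi> (i + 1)]\<^sub>L) - \<psi> (i + 1)"
    if "recursion_3021 A B \<psi>" for A B \<psi> :: "nat \<Rightarrow> 'a loop" and i
    using that [unfolded recursion_3021_def, THEN conjunct2, THEN conjunct2, rule_format, of "i + 1"]
    by simp_all
  have AB: "A' i = A i \<and> B' i = B i" for i
  proof (induction i)
    case 0
    show ?case
      using assms by (simp add: recursion_3021_def)
  next
    case (Suc i)
    then have "\<psi>' (i + 1) = \<psi> (i + 1)"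
      using step(1) [OF assms(1), of i] step(1) [OF assms(2), of i] by simp
    then show ?case
      using step(2,3) [OF assms(1), of i] step(2,3) [OF assms(2), of i] by simp
  qed
  then have "\<psi>' (i + 1) = \<psi> (i + 1)" for i
    using step(1) [OF assms(1), of i] step(1) [OF assms(2), of i] by simp
  with AB show ?thesis
    by (simp add: interleave_def fun_eq_iff)
qed

section \<open>The family, its brackets and its recursion\<close>

locale family_3021 =
  fixes Add Bdd \<psi> :: "nat \<Rightarrow> 'a::field_char_0 loop"
  assumes Add: "\<And>i. Add i = - (sl2_x \<otimes> (tp_t - 1) ^ i)"
    and Bdd: "\<And>i. Bdd i = (- (sl2_y \<otimes> tp_t) - sl2_z \<otimes> (tp_t - 1)) \<cdot> (tp_t - 1) ^ i"
    and psi: "\<And>i. \<psi> (i + 1) = (- (sl2_x \<otimes> 1) - sl2_y \<otimes> tp_t) \<cdot> (tp_t - 1) ^ i"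
begin

lemma coordinates:
  "Add i = Sl2 (- 2 * (tp_t - 1) ^ i) 0 ((tp_t - 1) ^ i)"
  "Bdd i = Sl2 0 (2 * tp_t * (tp_t - 1) ^ i) ((tp_t - 1) ^ i)"
  "\<psi> (i + 1) = Sl2 (- 2 * (tp_t - 1) ^ i) (2 * tp_t * (tp_t - 1) ^ i) ((tp_t + 1) * (tp_t - 1) ^ i)"
  unfolding Add Bdd psi
  by (simp_all add: tensor_equitable loop_act_def sl2_scale_def sl2_ops algebra_simps)

lemma initial: "Add 0 = - onsager_A" "Bdd 0 = - onsager_B"
  by (simp_all add: Add Bdd onsager_A_def onsager_B_def loop_act_tensor loop_act_def sl2_scale_def
      sl2_ops)

text \<open>Members of one kind are multiples of a single vector, so they commute. In the last two
  mixed brackets an extra factor \<open>t - 1\<close> raises the index by one.\<close>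

lemma brackets:
  "[Add i, Add j]\<^sub>L = 0"
  "[Bdd i, Bdd j]\<^sub>L = 0"
  "[\<psi> (i + 1), \<psi> (j + 1)]\<^sub>L = 0"
  "[Add i, Bdd j]\<^sub>L = 2 *\<^sub>F Add (i + j) + 2 *\<^sub>F Bdd (i + j) - 4 *\<^sub>F \<psi> (i + j + 1)"
  "[\<psi> (i + 1), Add j]\<^sub>L = 2 *\<^sub>F Add (i + j + 1) + 2 *\<^sub>F \<psi> (i + j + 1)"
  "[Bdd i, \<psi> (j + 1)]\<^sub>L = 2 *\<^sub>F Bdd (i + j + 1) + 2 *\<^sub>F \<psi> (i + j + 1)"
  unfolding coordinates
  by (simp_all add: lie_bracket_def loop_scale_def sl2_scale_def sl2_ops tp_const_2 tp_const_4
      power_add algebra_simps)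

lemma recursion: "recursion_3021 Add Bdd \<psi>"
proof -
  have gens: "onsager_A = - Add 0" "onsager_B = - Bdd 0"
    by (simp_all add: initial)
  have "\<psi> (j + 1) = (1/2) *\<^sub>F Add j + (1/2) *\<^sub>F Bdd j + (1/4) *\<^sub>F [Add j, onsager_B]\<^sub>L"
    "Add (j + 1) = - ((1/2) *\<^sub>F [\<psi> (j + 1), onsager_A]\<^sub>L) - \<psi> (j + 1)"
    "Bdd (j + 1) = - ((1/2) *\<^sub>F [onsager_B, \<psi> (j + 1)]\<^sub>L) - \<psi> (j + 1)" for j
    \<comment> \<open>With index 0 in one slot, a sign change gives the generators:
      \<open>[Add j, onsager_B]\<close> divided by 4 is \<open>\<psi> (j + 1)\<close> minus half of
      \<open>Add j\<close> and half of \<open>Bdd j\<close>.\<close>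
    using brackets(4) [of j 0] brackets(5) [of j 0] brackets(6) [of 0 j]
    by (simp_all add: gens bracket_neg loop.scale_right_distrib loop.scale_right_diff_distrib)
  then have "\<psi> i = (1/2) *\<^sub>F Add (i - 1) + (1/2) *\<^sub>F Bdd (i - 1) + (1/4) *\<^sub>F [Add (i - 1), onsager_B]\<^sub>L \<and>
        Add i = - ((1/2) *\<^sub>F [\<psi> i, onsager_A]\<^sub>L) - \<psi> i \<and>
        Bdd i = - ((1/2) *\<^sub>F [onsager_B, \<psi> i]\<^sub>L) - \<psi> i" if "1 \<le> i" for i
    using that by (metis le_add_diff_inverse2)
  then show ?thesis
    unfolding recursion_3021_def by (blast intro: initial)
qed

section \<open>The family as a basis of the Onsager algebra\<close>

abbreviation v where "v \<equiv> interleave Add Bdd \<psi>"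

lemma members:
  "Add i \<in> loop.span (range v)" "Bdd i \<in> loop.span (range v)" "\<psi> (i + 1) \<in> loop.span (range v)"
  by (intro loop.span_base, simp add: range_interleave)+

text \<open>Induction in the order of the recursion: each right-hand side uses only earlier members,
  the generators, brackets and scalars.\<close>

lemma span_le_onsager: "loop.span (range v) \<subseteq> onsager"
proof -
  have sub: "loop.subspace (onsager :: 'a loop set)"
    and br: "\<And>u w. u \<in> onsager \<Longrightarrow> w \<in> onsager \<Longrightarrow> [u, w]\<^sub>L \<in> (onsager :: 'a loop set)"
    using lie_subalgebra_onsager by (auto simp: lie_subalgebra_def)
  note closed = loop.subspace_add [OF sub] loop.subspace_diff [OF sub] loop.subspace_neg [OF sub]
    loop.subspace_scale [OF sub] br onsager_generators
  have psi_step: "\<psi> (i + 1) \<in> onsager" if "Add i \<in> onsager" "Bdd i \<in> onsager" for i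
    using recursion [unfolded recursion_3021_def, THEN conjunct2, THEN conjunct2, rule_format, of "i + 1"]
    by (simp add: closed that)
  have AB: "Add i \<in> onsager \<and> Bdd i \<in> onsager" for i
  proof (induction i)
    case 0
    show ?case
      by (simp add: initial closed)
  next
    case (Suc i)
    then show ?case
      using recursion [unfolded recursion_3021_def, THEN conjunct2, THEN conjunct2, rule_format, of "i + 1"]
        psi_step [of i]
      by (simp add: closed)
  qed
  then show ?thesis
    using psi_step by (intro loop.span_minimal sub) (auto simp: range_interleave)
qed

lemma onsager_le_span: "onsager \<subseteq> loop.span (range v)"
  unfolding onsager_def
proof (rule hull_minimal)
  have "(onsager_A :: 'a loop) = - Add 0" "(onsager_B :: 'a loop) = - Bdd 0"
    by (simp_all add: initial)
  then show "{onsager_A, onsager_B} \<subseteq> loop.span (range v)"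
    by (metis bot.extremum insert_subset loop.span_neg members(1,2))
  show "lie_subalgebra (loop.span (range v))"
  proof (rule lie_subalgebra_span)
    note closed = loop.span_zero loop.span_add loop.span_diff loop.span_neg loop.span_scale members
    \<comment> \<open>Three mixed brackets suffice: skew-symmetry gives the reversed ones, and
      brackets within one kind vanish.\<close>
    have "[Add i, Bdd j]\<^sub>L \<in> loop.span (range v)" "[\<psi> (i + 1), Add j]\<^sub>L \<in> loop.span (range v)"
      "[Bdd i, \<psi> (j + 1)]\<^sub>L \<in> loop.span (range v)" for i j
      unfolding brackets by (intro closed)+
    moreover from this have "[Bdd j, Add i]\<^sub>L \<in> loop.span (range v)"
      "[Add j, \<psi> (i + 1)]\<^sub>L \<in> loop.span (range v)"
      "[\<psi> (j + 1), Bdd i]\<^sub>L \<in> loop.span (range v)" for i j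
      by (metis bracket_swap loop.span_neg)+
    ultimately show "[u, w]\<^sub>L \<in> loop.span (range v)" if "u \<in> range v" "w \<in> range v" for u w
      using that unfolding range_interleave
      by (auto simp: brackets [simplified] loop.span_zero)
  qed
qed

lemma independent:
  assumes "(\<Sum>i<N. c i *\<^sub>F v i) = 0" "n < N"
  shows "c n = 0"
proof -
  \<comment> \<open>Zero-padding to length \<open>3 * N\<close> makes the sum split into complete
    blocks of three.\<close>
  define d where "d = (\<lambda>i. if i < N then c i else 0)"
  \<comment> \<open>The coefficients of the three kinds, gathered into polynomials in
    \<open>t - 1\<close>, so that the relation reads as three equations over a domain.\<close>
  define p q r where "p = (\<Sum>k<N. tp_const (d (3 * k)) * (tp_t - 1) ^ k)"
    and "q = (\<Sum>k<N. tp_const (d (3 * k + 1)) * (tp_t - 1) ^ k)"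
    and "r = (\<Sum>k<N. tp_const (d (3 * k + 2)) * (tp_t - 1) ^ k)"
  have "(\<Sum>i<N. c i *\<^sub>F v i) = (\<Sum>i<3 * N. d i *\<^sub>F v i)"
    by (intro sum.mono_neutral_cong_left) (auto simp: d_def)
  also have "\<dots> = (\<Sum>k<N. d (3 * k) *\<^sub>F Add k + d (3 * k + 1) *\<^sub>F Bdd k + d (3 * k + 2) *\<^sub>F \<psi> (k + 1))"
    by (simp add: sum_lessThan_triple)
  also have "\<dots> = Sl2 (- 2 * (p + r)) (2 * tp_t * (q + r)) (p + q + (tp_t + 1) * r)"
    unfolding coordinates p_def q_def r_def
    by (rule sl2.expand) (simp add: coeff_sum_sl2 loop_scale_def sl2_scale_def sl2_ops sum.distrib
        sum_distrib_left sum_subtractf sum_negf algebra_simps)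
  finally have zero: "- 2 * (p + r) = 0" "2 * tp_t * (q + r) = 0" "p + q + (tp_t + 1) * r = 0"
    using assms(1) by (simp_all only: zero_sl2_def sl2.inject)
  then have pq: "p = - r" "q = - r"
    using two_neq_zero_three_point tp_t_neq_0(1)
    by (auto simp: eq_neg_iff_add_eq_0 simp del: distrib_left_numeral)
  \<comment> \<open>Substituting \<open>p = q = - r\<close> into the third coordinate leaves
    \<open>(t + 1) r - 2 r\<close>.\<close>
  with zero(3) have "(tp_t - 1) * r = 0"
    by (simp add: algebra_simps)
  then have "r = 0"
    using tp_t_neq_0(2) mult_eq_0_iff by blast
  with pq have "p = 0" "q = 0"
    by simp_all
  then have "d (3 * k) = 0" "d (3 * k + 1) = 0" "d (3 * k + 2) = 0" if "k < N" for k
    using \<open>r = 0\<close> that unfolding p_def q_def r_def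
    by (simp_all only: powers_tp_t_minus_one_independent [of "\<lambda>k. d (3 * k)"]
        powers_tp_t_minus_one_independent [of "\<lambda>k. d (3 * k + 1)"]
        powers_tp_t_minus_one_independent [of "\<lambda>k. d (3 * k + 2)"])
  then have "d n = 0"
    \<comment> \<open>In each residue class modulo 3 the block index is at most \<open>n\<close>,
      hence below \<open>N\<close>.\<close>
    using \<open>n < N\<close> by (cases n rule: nat_mod_3_cases) auto
  then show ?thesis
    using \<open>n < N\<close> by (simp add: d_def)
qed

lemma basis: "family_basis_of v onsager"
  using loop.inj_independent_rangeI [of v] independent span_le_onsager onsager_le_span
  unfolding family_basis_of_def by blast

end

theorem corollary7p5:
  fixes Add Bdd \<psi> :: "nat \<Rightarrow> 'a::field_char_0 loop"
  assumes "\<And>i. Add i = - (sl2_x \<otimes> (tp_t - 1) ^ i)"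
    and "\<And>i. Bdd i = (- (sl2_y \<otimes> tp_t) - sl2_z \<otimes> (tp_t - 1)) \<cdot> (tp_t - 1) ^ i"
    and "\<And>i. \<psi> (i + 1) = (- (sl2_x \<otimes> 1) - sl2_y \<otimes> tp_t) \<cdot> (tp_t - 1) ^ i"
  shows "family_basis_of (interleave Add Bdd \<psi>) onsager \<and>
         recursion_3021 Add Bdd \<psi> \<and>
         (\<forall>Add' Bdd' \<psi>'. recursion_3021 Add' Bdd' \<psi>' \<longrightarrow>
            interleave Add' Bdd' \<psi>' = interleave Add Bdd \<psi>)"
proof -
  interpret family_3021 Add Bdd \<psi>
    by unfold_locales (fact assms)+
  show ?thesis
    using basis recursion recursion_3021_unique by blast
qed

end
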